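(* Fix $p\in[1,\infty)$. For all sufficiently large $n\in\mathbb{N}$ and every $\epsilon\ge10/n$, any one-pass, insertion-only streaming algorithm which processes a set $P$ of $n$ points in $\{0,1\}^{2n}$ and outputs a number $\boldsymbol{\eta}\in\mathbb{R}_{\ge0}$ satisfying \[ \min_{z\in P}\sum_{x\in P}\|x-z\|_p^p\le\boldsymbol{\eta}\le(2-\epsilon)\min_{z\in P}\sum_{x\in P}\|x-z\|_p^p \] with probability at least $9/10$ must use $\Omega(\epsilon n)$ bits of space.
   Context: A one-pass insertion-only streaming algorithm reads the points of $P$ once, one at a time, with limited memory (and may use randomness). $\|\cdot\|_p$ is the $\ell_p$ norm. *)

theory Defs
  imports "HOL-Probability.Probability" "HOL-Combinatorics.Multiset_Permutations"
begin

definition lp_norm :: "real \<Rightarrow> nat \<Rightarrow> (nat \<Rightarrow> real) \<Rightarrow> real" where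
  "lp_norm p d x = (\<Sum>i<d. \<bar>x i\<bar> powr p) powr (1 / p)"

definition cube :: "nat \<Rightarrow> (nat \<Rightarrow> real) set" where
  "cube d = {..<d} \<rightarrow>\<^sub>E {0, 1}"

definition medoid_cost :: "real \<Rightarrow> nat \<Rightarrow> (nat \<Rightarrow> real) set \<Rightarrow> real" where
  "medoid_cost p d P = Min ((\<lambda>z. \<Sum>x\<in>P. lp_norm p d (\<lambda>i. x i - z i) powr p) ` P)"

definition coin_tape :: "(nat \<Rightarrow> bool) measure" where
  "coin_tape = (\<Pi>\<^sub>M i\<in>UNIV. measure_pmf (bernoulli_pmf (1/2)))"

text \<open>
  The memory between two consecutive stream elements is a bit string. The coin tape is
  not charged to the memory, and neither is the position in the stream that is passed to
  the transition function. With this, a transition may use coins that no earlier transition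
  has looked at (fresh randomness in every step), or coins shared between transitions.
  The functions need not be computable, so an algorithm may be tailored to \<open>n\<close> and \<open>\<epsilon>\<close>.
\<close>

record 'x streaming_algorithm =
  init :: "(nat \<Rightarrow> bool) \<Rightarrow> bool list"
  update :: "(nat \<Rightarrow> bool) \<Rightarrow> nat \<Rightarrow> bool list \<Rightarrow> 'x \<Rightarrow> bool list"
  answer :: "(nat \<Rightarrow> bool) \<Rightarrow> bool list \<Rightarrow> real"

definition measurable_algorithm :: "'x streaming_algorithm \<Rightarrow> bool" where
  "measurable_algorithm A \<longleftrightarrow>
     init A \<in> coin_tape \<rightarrow>\<^sub>M count_space UNIV \<and>
     (\<forall>t m x. (\<lambda>r. update A r t m x) \<in> coin_tape \<rightarrow>\<^sub>M count_space UNIV) \<and>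
     (\<forall>m. (\<lambda>r. answer A r m) \<in> borel_measurable coin_tape)"

primrec memory ::
  "'x streaming_algorithm \<Rightarrow> (nat \<Rightarrow> bool) \<Rightarrow> 'x list \<Rightarrow> nat \<Rightarrow> bool list" where
  "memory A r xs 0 = init A r"
| "memory A r xs (Suc t) = update A r t (memory A r xs t) (xs ! t)"

definition final_answer :: "'x streaming_algorithm \<Rightarrow> (nat \<Rightarrow> bool) \<Rightarrow> 'x list \<Rightarrow> real" where
  "final_answer A r xs = answer A r (memory A r xs (length xs))"

text \<open>
  A stream presents the \<open>n\<close> distinct points of \<open>P\<close> in an arbitrary order, each exactly once.
\<close>

definition input_sets :: "nat \<Rightarrow> nat \<Rightarrow> (nat \<Rightarrow> real) set set" where
  "input_sets n d = {P. P \<subseteq> cube d \<and> card P = n \<and> finite P}"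

definition space_at_most ::
  "nat \<Rightarrow> nat \<Rightarrow> (nat \<Rightarrow> real) streaming_algorithm \<Rightarrow> nat \<Rightarrow> bool" where
  "space_at_most n d A s \<longleftrightarrow>
     (\<forall>P\<in>input_sets n d. \<forall>xs\<in>permutations_of_set P. \<forall>r\<in>space coin_tape. \<forall>t\<le>length xs.
        length (memory A r xs t) \<le> s)"

definition approximates_medoid_cost ::
  "real \<Rightarrow> nat \<Rightarrow> nat \<Rightarrow> real \<Rightarrow> (nat \<Rightarrow> real) streaming_algorithm \<Rightarrow> bool" where
  "approximates_medoid_cost p n d \<alpha> A \<longleftrightarrow>
     (\<forall>P\<in>input_sets n d. \<forall>xs\<in>permutations_of_set P.
        (\<forall>r\<in>space coin_tape. 0 \<le> final_answer A r xs) \<and>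
        \<P>(r in coin_tape. medoid_cost p d P \<le> final_answer A r xs \<and>
                          final_answer A r xs \<le> \<alpha> * medoid_cost p d P) \<ge> 9/10)"

end

theory Submission
  imports Defs
begin

text \<open>
  Reduction from one-way INDEX. A set \<open>a\<close> of indices below \<open>m\<close>, where \<open>m\<close> is about \<open>\<epsilon> n / 2\<close>, is
  streamed as \<open>m\<close> unit vectors, among which \<open>e\<^sub>i\<close> occurs iff \<open>i \<in> a\<close>. The remaining \<open>n - m\<close> points
  \<open>e\<^sub>i + e\<^sub>m\<^sub>+\<^sub>k\<close> lie at distance 1 from \<open>e\<^sub>i\<close> and at distance 2 from each other, so the medoid cost is at
  most \<open>n + m - 2\<close> if \<open>i \<in> a\<close> and at least \<open>2 n + m - 2\<close> otherwise, and a \<open>(2 - \<epsilon>)\<close>-approximation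
  tells the two cases apart. For suitable fixed coins, the memory after the first \<open>m\<close> points therefore
  determines a set \<open>D a\<close> that differs from \<open>a\<close> in at most \<open>m / 10\<close> indices on average. Weighting
  each \<open>a\<close> by \<open>(1/4)\<close> to the number of these differences, the total weight is at most \<open>(5/4)\<^sup>m\<close> per
  memory state, and by convexity at least \<open>2\<^sup>m (1/4)\<close> to the power \<open>m / 10\<close>; hence there are at least
  \<open>4\<close> to the power \<open>m / 5\<close> memory states.
\<close>

section \<open>Counting the values of a decoder with small average error\<close>

lemma sum_power_card_Pow:
  fixes x :: real
  assumes "finite S"
  shows "(\<Sum>B\<in>Pow S. x ^ card B) = (1 + x) ^ card S"
  using prod_add[OF assms, of "\<lambda>_. x" "\<lambda>_. 1"] by (simp add: add.commute)

text \<open>Symmetric difference with \<open>C\<close> is an involution of \<open>Pow S\<close>, so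
  this reduces to the binomial sum around the empty set.\<close>

lemma sum_power_card_sym_diff:
  fixes x :: real
  assumes "finite S" "C \<subseteq> S"
  shows "(\<Sum>B\<in>Pow S. x ^ card (sym_diff B C)) = (1 + x) ^ card S"
proof -
  have "bij_betw (\<lambda>B. sym_diff B C) (Pow S) (Pow S)"
    by (rule bij_betwI[where g = "\<lambda>B. sym_diff B C"]) (use assms in auto)
  from sum.reindex_bij_betw[OF this, of "\<lambda>B. x ^ card B"] show ?thesis
    using sum_power_card_Pow[OF assms(1)] by simp
qed

lemma card_image_decoder:
  fixes D :: "'a set \<Rightarrow> 'a set"
  assumes S: "finite S" and D: "\<And>B. B \<subseteq> S \<Longrightarrow> D B \<subseteq> S"
    and err: "(\<Sum>B\<in>Pow S. real (card (sym_diff B (D B)))) \<le> real (card S) * 2 ^ card S / 10"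
  shows "4 ^ card S \<le> card (D ` Pow S) ^ 5"
proof -
  define m where "m = card S"
  \<comment> \<open>\<open>q\<close> is (1/4)^(m/10), the weight at the permitted average
    error.\<close>
  define q :: real where "q = exp (ln (1/4) * (m / 10))"
  define K where "K = real (card (D ` Pow S))"
  \<comment> \<open>Tangent at \<open>m / 10\<close> to the convex function d -> (1/4)^d; summed
    over all \<open>B\<close>, it gives Jensen's inequality.\<close>
  have tangent: "q * (1 + ln (1/4) * (real d - m / 10)) \<le> (1/4) ^ d" for d :: nat
  proof -
    have "(1/4::real) ^ d = exp (ln (1/4) * d)"
      by (metis exp_ln exp_of_nat2_mult zero_less_divide_1_iff zero_less_numeral)
    also have "\<dots> = q * exp (ln (1/4) * (real d - m / 10))"
      by (simp add: q_def exp_add[symmetric] algebra_simps)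
    finally show ?thesis
      by (simp add: q_def exp_ge_add_one_self)
  qed
  have "q * 2 ^ m \<le> q * (2 ^ m + ln (1/4) * ((\<Sum>B\<in>Pow S. real (card (sym_diff B (D B)))) - m * 2 ^ m / 10))"
    using err by (intro mult_left_mono) (auto simp: q_def m_def intro!: mult_nonpos_nonpos)
  also have "\<dots> = (\<Sum>B\<in>Pow S. q * (1 + ln (1/4) * (real (card (sym_diff B (D B))) - m / 10)))"
    by (simp add: sum_distrib_left[symmetric] sum.distrib sum_subtractf card_Pow S m_def algebra_simps)
  also have "\<dots> \<le> (\<Sum>B\<in>Pow S. (1/4) ^ card (sym_diff B (D B)))"
    by (intro sum_mono tangent)
  \<comment> \<open>The inner sum contains the term \<open>C = D B\<close>. After the swap, each
    value \<open>C\<close> contributes the same amount.\<close>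
  also have "\<dots> \<le> (\<Sum>B\<in>Pow S. \<Sum>C\<in>D ` Pow S. (1/4) ^ card (sym_diff B C))"
    by (intro sum_mono member_le_sum) (use S in auto)
  also have "\<dots> = (\<Sum>C\<in>D ` Pow S. \<Sum>B\<in>Pow S. (1/4) ^ card (sym_diff B C))"
    by (rule sum.swap)
  also have "\<dots> = (\<Sum>C\<in>D ` Pow S. (5/4) ^ m)"
    using D S by (intro sum.cong refl) (auto simp: sum_power_card_sym_diff m_def)
  finally have "q * 2 ^ m \<le> K * (5/4) ^ m"
    by (simp add: K_def)
  \<comment> \<open>The fifth power turns the exponent m/10 of 1/4 into m/2, hence into a power of
    1/2.\<close>
  then have "(q * 2 ^ m) ^ 5 \<le> (K * (5/4) ^ m) ^ 5"
    by (intro power_mono) (auto simp: q_def)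
  moreover have "q ^ 5 = (1/2) ^ m"
  proof -
    have "q ^ 5 = exp (m * (ln (1/4) / 2))"
      by (simp add: q_def exp_of_nat_mult[symmetric])
    also have "\<dots> = exp (ln (1/4) / 2) ^ m"
      by (rule exp_of_nat_mult)
    also have "ln (1/4::real) / 2 = ln (1/2)"
      using ln_realpow[of "1/2::real" 2] by (simp add: power2_eq_square)
    finally show ?thesis by simp
  qed
  ultimately have "(1/2) ^ m * (2 ^ 5) ^ m \<le> K ^ 5 * ((5/4) ^ 5) ^ m"
    by (simp only: power_mult_distrib power_mult[symmetric] mult.commute)
  then have "(1/2 * 2 ^ 5) ^ m \<le> K ^ 5 * ((5/4) ^ 5) ^ m"
    by (simp only: power_mult_distrib)
  \<comment> \<open>Numerically, 4 (5/4)^5 < 13 < 16.\<close>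
  moreover have "(4::real) ^ m * ((5/4) ^ 5) ^ m \<le> (1/2 * 2 ^ 5) ^ m"
    unfolding power_mult_distrib[symmetric] by (intro power_mono) (simp_all add: power_divide)
  ultimately have "(4::real) ^ m * ((5/4) ^ 5) ^ m \<le> K ^ 5 * ((5/4) ^ 5) ^ m"
    by linarith
  then have "(4::real) ^ m \<le> K ^ 5"
    by (rule mult_right_le_imp_le) simp
  then show ?thesis
    unfolding K_def m_def
    using of_nat_le_iff[of "4 ^ card S" "card (D ` Pow S) ^ 5", where ?'a = real] by simp
qed

section \<open>Fixing the coins, and memory as a one-way message\<close>

text \<open>The expected number of events that occur is at least \<open>q * card I\<close>, so some
  outcome attains this. It serves to fix the coins.\<close>

lemma (in prob_space) exists_sum_indicator_ge:
  fixes q :: real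
  assumes "finite I" "\<And>i. i \<in> I \<Longrightarrow> E i \<in> events" "\<And>i. i \<in> I \<Longrightarrow> q \<le> prob (E i)"
  shows "\<exists>r\<in>space M. q * card I \<le> (\<Sum>i\<in>I. indicator (E i) r)"
proof (rule ccontr)
  assume neg: "\<not> ?thesis"
  have int: "integrable M (\<lambda>r. \<Sum>i\<in>I. indicator (E i) r :: real)"
    using assms(2) by (intro Bochner_Integration.integrable_sum integrable_real_indicator) (auto simp: less_top[symmetric])
  have "expectation (\<lambda>r. \<Sum>i\<in>I. indicator (E i) r) < q * card I"
    by (rule expectation_less[OF int]) (use neg in \<open>auto intro!: AE_I2 simp: not_le\<close>)
  moreover have "expectation (\<lambda>r. \<Sum>i\<in>I. indicator (E i) r) = (\<Sum>i\<in>I. prob (E i))"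
    using assms(2) by (subst Bochner_Integration.integral_sum) (auto intro!: sum.cong simp: less_top[symmetric])
  moreover have "q * card I \<le> (\<Sum>i\<in>I. prob (E i))"
    using sum_mono[OF assms(3), of I] by (simp add: mult.commute)
  ultimately show False by linarith
qed

lemma prob_space_coin_tape: "prob_space coin_tape"
  unfolding coin_tape_def by (intro prob_space_PiM prob_space_measure_pmf)

text \<open>The rest of the run sees the earlier points only through the memory, which thus acts as
  the message in INDEX.\<close>

lemma memory_append_cong:
  assumes "memory A r xs m = memory A r ys m"
    and "\<And>t. m \<le> t \<Longrightarrow> t < m + k \<Longrightarrow> xs ! t = ys ! t"
  shows "memory A r xs (m + k) = memory A r ys (m + k)"
  using assms(2) by (induction k) (simp_all add: assms(1))

lemma memory_cong:
  "(\<And>t. t < m \<Longrightarrow> xs ! t = ys ! t) \<Longrightarrow> memory A r xs m = memory A r ys m"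
  by (induction m) simp_all

lemma card_bool_lists_length_le: "card {l :: bool list. length l \<le> s} < 2 ^ Suc s"
proof -
  have "card {l :: bool list. length l \<le> s} = (\<Sum>i\<le>s. 2 ^ i)"
    using card_lists_length_le[of "UNIV :: bool set" s] by simp
  also have "\<dots> < 2 ^ Suc s"
    by (induction s) simp_all
  finally show ?thesis .
qed

section \<open>Points of the cube and Hamming distance\<close>

definition cube_point :: "nat \<Rightarrow> nat set \<Rightarrow> nat \<Rightarrow> real" where
  "cube_point d T = restrict (indicator T) {..<d}"

lemma cube_point_in_cube: "cube_point d T \<in> cube d"
  by (auto simp: cube_point_def cube_def indicator_def)

lemma cube_point_eq_iff:
  assumes "T \<subseteq> {..<d}" "U \<subseteq> {..<d}"
  shows "cube_point d T = cube_point d U \<longleftrightarrow> T = U"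
proof
  assume eq: "cube_point d T = cube_point d U"
  have "k \<in> T \<longleftrightarrow> k \<in> U" if "k < d" for k
    using fun_cong[OF eq, of k] that by (auto simp: cube_point_def indicator_def split: if_splits)
  then show "T = U" using assms by blast
qed simp

text \<open>Coordinate differences are -1, 0 or 1, so their \<open>p\<close>-th powers do not depend
  on \<open>p\<close>.\<close>

lemma lp_norm_cube_point_diff:
  assumes "1 \<le> p" "T \<subseteq> {..<d}" "U \<subseteq> {..<d}"
  shows "lp_norm p d (\<lambda>i. cube_point d T i - cube_point d U i) powr p = card (sym_diff T U)"
proof -
  have "(\<Sum>i<d. \<bar>cube_point d T i - cube_point d U i\<bar> powr p) = (\<Sum>i<d. indicator (sym_diff T U) i)"
    using assms(1) by (intro sum.cong) (auto simp: cube_point_def indicator_def)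
  also have "\<dots> = card ({..<d} \<inter> sym_diff T U)"
    using sum_mult_indicator[of "{..<d}" "\<lambda>_. 1 :: real" "\<lambda>_. sym_diff T U" "\<lambda>i. i"]
    by (simp add: Int_def)
  also have "{..<d} \<inter> sym_diff T U = sym_diff T U"
    using assms by auto
  finally show ?thesis
    using assms(1) by (simp add: lp_norm_def powr_powr)
qed

section \<open>The hard streams and their medoid costs\<close>

text \<open>The offset \<open>m\<close> separates three blocks of coordinates: members below
  \<open>m\<close>, substitutes for nonmembers in [m, 2m), tags of the later points from 2m on. The
  first \<open>m\<close> sets do not depend on \<open>i\<close>, the later ones not on
  \<open>a\<close>.\<close>

definition index_set :: "nat \<Rightarrow> nat set \<Rightarrow> nat \<Rightarrow> nat \<Rightarrow> nat set" where
  "index_set m a i k = (if k < m then {if k \<in> a then k else m + k} else {i, m + k})"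

definition index_stream :: "nat \<Rightarrow> nat \<Rightarrow> nat set \<Rightarrow> nat \<Rightarrow> (nat \<Rightarrow> real) list" where
  "index_stream n m a i = map (\<lambda>k. cube_point (2 * n) (index_set m a i k)) [0..<n]"

lemma length_index_stream [simp]: "length (index_stream n m a i) = n"
  by (simp add: index_stream_def)

lemma index_set_subset:
  assumes "m \<le> n" "i < m" "k < n"
  shows "index_set m a i k \<subseteq> {..<2 * n}"
  using assms by (auto simp: index_set_def)

lemma inj_index_set:
  assumes "i < m"
  shows "inj (index_set m a i)"
proof (rule injI)
  fix k l assume "index_set m a i k = index_set m a i l"
  then show "k = l"
    using assms by (auto simp: index_set_def doubleton_eq_iff split: if_splits)
qed

lemma inj_on_index_point:
  assumes "m \<le> n" "i < m"
  shows "inj_on (\<lambda>k. cube_point (2 * n) (index_set m a i k)) {..<n}"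
  using assms injD[OF inj_index_set[of i m a]]
  by (auto simp: inj_on_def cube_point_eq_iff index_set_subset)

lemma index_stream_permutation:
  assumes "m \<le> n" "i < m"
  shows "set (index_stream n m a i) \<in> input_sets n (2 * n)"
    and "index_stream n m a i \<in> permutations_of_set (set (index_stream n m a i))"
proof -
  have "distinct (index_stream n m a i)"
    using inj_on_index_point[OF assms, of a]
    by (simp add: index_stream_def distinct_map lessThan_atLeast0)
  then show "set (index_stream n m a i) \<in> input_sets n (2 * n)"
    "index_stream n m a i \<in> permutations_of_set (set (index_stream n m a i))"
    using distinct_card[of "index_stream n m a i"]
    by (auto simp: input_sets_def permutations_of_set_def index_stream_def cube_point_in_cube)
qed

lemma medoid_cost_index_stream:
  assumes "1 \<le> p" "m \<le> n" "i < m"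
  shows "medoid_cost p (2 * n) (set (index_stream n m a i))
       = Min ((\<lambda>j. real (\<Sum>k<n. card (sym_diff (index_set m a i k) (index_set m a i j)))) ` {..<n})"
proof -
  let ?f = "\<lambda>k. cube_point (2 * n) (index_set m a i k)"
  have set: "set (index_stream n m a i) = ?f ` {..<n}"
    by (simp add: index_stream_def lessThan_atLeast0)
  show ?thesis
    unfolding medoid_cost_def set image_image
      sum.reindex[OF inj_on_index_point[OF assms(2,3)]] o_def of_nat_sum
    by (intro arg_cong[where f = Min] image_cong refl sum.cong)
      (use assms in \<open>auto simp: lp_norm_cube_point_diff index_set_subset\<close>)
qed

lemma sum_if_less_const:
  fixes c e :: nat
  assumes "m \<le> n"
  shows "(\<Sum>k<n. if k < m then c else e) = m * c + (n - m) * e"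
proof -
  have "(\<Sum>k<n. if k < m then c else e)
      = (\<Sum>k\<in>{..<n} \<inter> {k. k < m}. c) + (\<Sum>k\<in>{..<n} \<inter> - {k. k < m}. e)"
    by (simp add: sum.If_cases)
  also have "{..<n} \<inter> {k. k < m} = {..<m}"
    using assms by auto
  also have "{..<n} \<inter> - {k. k < m} = {m..<n}"
    by auto
  finally show ?thesis by simp
qed

lemma medoid_cost_index_member_le:
  assumes "1 \<le> p" "m \<le> n" "i < m" "i \<in> a"
  shows "medoid_cost p (2 * n) (set (index_stream n m a i)) \<le> n + m - 2"
proof -
  let ?d = "\<lambda>k. card (sym_diff (index_set m a i k) (index_set m a i i))"
  have "?d k \<le> (if k < m then 2 else 1)" for k
  proof (cases "k < m")
    case True
    have "?d k \<le> card {if k \<in> a then k else m + k, i}"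
      using True assms by (intro card_mono) (auto simp: index_set_def)
    also have "\<dots> \<le> 2"
      by (simp add: card_insert_if)
    finally show ?thesis using True by simp
  next
    case False
    have "?d k \<le> card {m + k}"
      using False assms by (intro card_mono) (auto simp: index_set_def)
    then show ?thesis using False by simp
  qed
  then have "sum ?d ({..<n} - {i}) \<le> (\<Sum>k\<in>{..<n} - {i}. if k < m then 2 else 1)"
    by (intro sum_mono)
  \<comment> \<open>The centre has distance 0 to itself but is counted as 2 in the full sum, whence
    the - 2.\<close>
  moreover have "sum ?d {..<n} = ?d i + sum ?d ({..<n} - {i})"
    using assms by (intro sum.remove) auto
  moreover have "(\<Sum>k<n. if k < m then 2 else 1 :: nat)
      = 2 + (\<Sum>k\<in>{..<n} - {i}. if k < m then 2 else 1)"
    using assms by (subst sum.remove[of _ i]) auto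
  ultimately have "sum ?d {..<n} + 2 \<le> n + m"
    using sum_if_less_const[OF assms(2), of 2 1] assms by simp
  moreover have "medoid_cost p (2 * n) (set (index_stream n m a i)) \<le> real (sum ?d {..<n})"
    unfolding medoid_cost_index_stream[OF assms(1-3)] using assms by (intro Min_le) auto
  ultimately show ?thesis by linarith
qed

lemma medoid_cost_index_nonmember_ge:
  assumes "1 \<le> p" "2 * m \<le> n" "i < m" "i \<notin> a"
  shows "2 * n + m - 2 \<le> medoid_cost p (2 * n) (set (index_stream n m a i))"
proof -
  have mn: "m \<le> n" using assms by simp
  have "2 * n + m \<le> (\<Sum>k<n. card (sym_diff (index_set m a i k) (index_set m a i j))) + 2"
    if j: "j < n" for j
  proof -
    let ?d = "\<lambda>k. card (sym_diff (index_set m a i k) (index_set m a i j))"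
    \<comment> \<open>Lower bounds on the distance from centre \<open>j\<close> to early and late
      points. As \<open>i \<notin> a\<close>, no early singleton is {i}, so early and late points
      are at distance 3. The bound assigned to \<open>k = j\<close> is always 2.\<close>
    let ?c = "if j < m then 2 else 3 :: nat" and ?e = "if j < m then 3 else 2 :: nat"
    have d: "(if k < m then ?c else ?e) \<le> ?d k" if "k \<noteq> j" for k
    proof (cases "k < m"; cases "j < m")
      assume k: "k < m" "j < m"
      define u v where "u = (if k \<in> a then k else m + k)" and "v = (if j \<in> a then j else m + j)"
      have "u \<noteq> v"
        using k that unfolding u_def v_def by (smt (verit) add_left_imp_eq not_add_less1)
      then have "sym_diff (index_set m a i k) (index_set m a i j) = {u, v}"
        unfolding index_set_def u_def[symmetric] v_def[symmetric] using k by auto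
      then show ?thesis using k \<open>u \<noteq> v\<close> by simp
    next
      assume k: "k < m" "\<not> j < m"
      then have "sym_diff (index_set m a i k) (index_set m a i j)
        = {if k \<in> a then k else m + k, i, m + j}"
        using that assms by (auto simp: index_set_def)
      then show ?thesis using k assms by (auto simp: card_insert_if)
    next
      assume k: "\<not> k < m" "j < m"
      then have "sym_diff (index_set m a i k) (index_set m a i j)
        = {if j \<in> a then j else m + j, i, m + k}"
        using that assms by (auto simp: index_set_def)
      then show ?thesis using k assms by (auto simp: card_insert_if)
    next
      assume k: "\<not> k < m" "\<not> j < m"
      then have "sym_diff (index_set m a i k) (index_set m a i j) = {m + k, m + j}"
        using that assms by (auto simp: index_set_def)
      then show ?thesis using k that by (auto simp: card_insert_if)
    qed
    have "(\<Sum>k<n. if k < m then ?c else ?e)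
        = 2 + (\<Sum>k\<in>{..<n} - {j}. if k < m then ?c else ?e)"
      using j by (subst sum.remove[of _ j]) auto
    also have "\<dots> \<le> 2 + sum ?d ({..<n} - {j})"
      using d by (intro add_left_mono sum_mono) auto
    also have "\<dots> \<le> 2 + sum ?d {..<n}"
      by (intro add_left_mono sum_mono2) auto
    finally have "m * ?c + (n - m) * ?e \<le> sum ?d {..<n} + 2"
      using sum_if_less_const[OF mn, of ?c ?e] by simp
    \<comment> \<open>For \<open>j < m\<close> the right side is 3n - m, which is large enough by
      \<open>2 * m \<le> n\<close>; otherwise equality holds.\<close>
    moreover have "2 * n + m \<le> m * ?c + (n - m) * ?e"
      using assms(2) by auto
    ultimately show ?thesis by linarith
  qed
  then have "real (2 * n + m - 2) \<le> real (\<Sum>k<n. card (sym_diff (index_set m a i k) (index_set m a i j)))"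
    if "j < n" for j
    using that by (metis le_diff_conv of_nat_le_iff)
  then show ?thesis
    unfolding medoid_cost_index_stream[OF assms(1) mn assms(3)]
    using assms by (intro Min.boundedI) (auto simp: lessThan_empty_iff)
qed

section \<open>Reduction from INDEX and choice of parameters\<close>

lemma index_lower_bound:
  fixes p \<epsilon> :: real and m n s :: nat
  assumes p: "1 \<le> p" and m: "0 < m" "2 * m \<le> n" and \<epsilon>: "\<epsilon> \<le> 1" "2 * real m \<le> \<epsilon> * real n"
    and approx: "approximates_medoid_cost p n (2 * n) (2 - \<epsilon>) A"
    and space: "space_at_most n (2 * n) A s"
  shows "2 * m < 5 * (s + 1)"
proof -
  interpret prob_space coin_tape by (rule prob_space_coin_tape)
  have mn: "m \<le> n" using m by simp
  let ?x = "index_stream n m"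
  let ?cost = "\<lambda>a i. medoid_cost p (2 * n) (set (?x a i))"
  define I where "I = Pow {..<m} \<times> {..<m}"
  define E where "E = (\<lambda>(a, i). {r \<in> space coin_tape. ?cost a i \<le> final_answer A r (?x a i) \<and>
    final_answer A r (?x a i) \<le> (2 - \<epsilon>) * ?cost a i})"
  have prob: "9/10 \<le> prob (E z)" if "z \<in> I" for z
    using that approx index_stream_permutation[OF mn]
    by (auto simp: approximates_medoid_cost_def E_def I_def)
  \<comment> \<open>A non-measurable set would have the junk measure 0.\<close>
  have events: "E z \<in> events" if "z \<in> I" for z
    using prob[OF that] measure_notin_sets[of "E z" coin_tape] by fastforce
  obtain r where r: "r \<in> space coin_tape" "9/10 * card I \<le> (\<Sum>z\<in>I. indicator (E z) r)"
    using exists_sum_indicator_ge[of I E "9/10"] prob events by (auto simp: I_def)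
  \<comment> \<open>The largest correct answer possible for a member is at most
    \<open>\<tau>\<close>; the decoder \<open>D\<close> thresholds there.\<close>
  define \<tau> where "\<tau> = (2 - \<epsilon>) * real (n + m - 2)"
  define D where "D a = {i \<in> {..<m}. final_answer A r (?x a i) \<le> \<tau>}" for a
  have \<tau>: "\<tau> < 2 * real n + real m - 2"
  proof -
    have "0 < \<epsilon> * n"
      using \<epsilon>(2) m(1) by linarith
    then have "0 < \<epsilon>"
      using zero_less_mult_pos2 m by fastforce
    then have "0 \<le> \<epsilon> * m" by simp
    have "\<tau> = 2 * real n + 2 * real m - 4 - \<epsilon> * n - \<epsilon> * m + 2 * \<epsilon>"
      using m by (simp add: \<tau>_def of_nat_diff algebra_simps)
    also have "\<dots> < 2 * real n + real m - 2"
      using \<epsilon> m(1) \<open>0 \<le> \<epsilon> * m\<close> by linarith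
    finally show ?thesis .
  qed
  have correct: "i \<in> D a \<longleftrightarrow> i \<in> a" if "i < m" "r \<in> E (a, i)" for a i
  proof -
    have ans: "?cost a i \<le> final_answer A r (?x a i)"
      "final_answer A r (?x a i) \<le> (2 - \<epsilon>) * ?cost a i"
      using that by (auto simp: E_def)
    show ?thesis
    proof (cases "i \<in> a")
      case True
      have "(2 - \<epsilon>) * ?cost a i \<le> \<tau>"
        unfolding \<tau>_def using \<epsilon>(1) medoid_cost_index_member_le[OF p mn that(1) True]
        by (intro mult_left_mono) auto
      then show ?thesis using True that ans by (auto simp: D_def)
    next
      case False
      then show ?thesis
        using medoid_cost_index_nonmember_ge[OF p m(2) that(1) False] ans \<tau> by (auto simp: D_def)
    qed
  qed
  \<comment> \<open>Each wrongly decoded index is a pair on which the run with coins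
    \<open>r\<close> fails, and at most a tenth of all pairs fail.\<close>
  have "(\<Sum>a\<in>Pow {..<m}. real (card (sym_diff a (D a)))) \<le> real m * 2 ^ m / 10"
  proof -
    have "real (card (sym_diff a (D a))) \<le> (\<Sum>i<m. 1 - indicator (E (a, i)) r)"
      if "a \<in> Pow {..<m}" for a
    proof -
      have "real (card (sym_diff a (D a))) = (\<Sum>i\<in>sym_diff a (D a). 1 - indicator (E (a, i)) r)"
        using that correct by (subst sum.cong[OF refl, of _ _ "\<lambda>_. 1"]) (auto simp: indicator_def D_def)
      also have "\<dots> \<le> (\<Sum>i<m. 1 - indicator (E (a, i)) r)"
        using that by (intro sum_mono2) (auto simp: D_def indicator_def)
      finally show ?thesis .
    qed
    then have "(\<Sum>a\<in>Pow {..<m}. real (card (sym_diff a (D a))))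
        \<le> (\<Sum>a\<in>Pow {..<m}. \<Sum>i<m. 1 - indicator (E (a, i)) r)"
      by (rule sum_mono)
    also have "\<dots> = (\<Sum>z\<in>I. 1 - indicator (E z) r)"
      by (simp add: I_def sum.cartesian_product split_def)
    also have "\<dots> = real (card I) - (\<Sum>z\<in>I. indicator (E z) r)"
      by (simp add: sum_subtractf)
    also have "\<dots> \<le> real (card I) / 10"
      using r(2) by simp
    also have "card I = m * 2 ^ m"
      by (simp add: I_def card_cartesian_product card_Pow)
    finally show ?thesis by simp
  qed
  then have "4 ^ m \<le> card (D ` Pow {..<m}) ^ 5"
    using card_image_decoder[of "{..<m}" D] by (auto simp: D_def)
  moreover have "card (D ` Pow {..<m}) < 2 ^ (s + 1)"
  proof -
    \<comment> \<open>The query 0 is an arbitrary representative, valid since \<open>0 < m\<close>: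
      the first \<open>m\<close> points are the same for every \<open>i\<close>.\<close>
    define F where "F a = memory A r (?x a 0) m" for a
    have F: "memory A r (?x a i) m = F a" for a i
      unfolding F_def using mn by (intro memory_cong) (simp add: index_stream_def index_set_def)
    have "D a = D b" if "F a = F b" for a b
    proof -
      have "memory A r (?x a i) (m + (n - m)) = memory A r (?x b i) (m + (n - m))" for i
        using that F by (intro memory_append_cong) (auto simp: index_stream_def index_set_def)
      then show ?thesis
        using mn by (simp add: D_def final_answer_def index_stream_def)
    qed
    \<comment> \<open>\<open>D\<close> factors through \<open>F\<close>, so it has at most as many
      values as there are memory states.\<close>
    then have "D ` Pow {..<m} = (\<lambda>\<mu>. D (SOME a. F a = \<mu>)) ` F ` Pow {..<m}"
      unfolding image_image by (intro image_cong refl) (metis (mono_tags, lifting) someI)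
    moreover have "length (F a) \<le> s" for a
    proof -
      have "\<forall>t\<le>n. length (memory A r (?x a 0) t) \<le> s"
        using space r(1) index_stream_permutation[OF mn m(1), of a] length_index_stream[of n m a 0]
        unfolding space_at_most_def by metis
      then show ?thesis using mn by (simp add: F_def)
    qed
    ultimately have "card (D ` Pow {..<m}) \<le> card (F ` Pow {..<m})"
      by (simp add: card_image_le)
    also have "\<dots> \<le> card {l :: bool list. length l \<le> s}"
      using \<open>\<And>a. length (F a) \<le> s\<close> finite_lists_length_le[of "UNIV :: bool set" s]
      by (intro card_mono) auto
    also have "\<dots> < 2 ^ (s + 1)"
      using card_bool_lists_length_le[of s] by simp
    finally show ?thesis .
  qed
  then have "card (D ` Pow {..<m}) ^ 5 < (2 ^ (s + 1)) ^ 5"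
    by (intro power_strict_mono) auto
  ultimately have "(2::nat) ^ (2 * m) < 2 ^ ((s + 1) * 5)"
    by (simp only: power_mult) simp
  then show ?thesis by (simp add: power_strict_increasing_iff)
qed

text \<open>For \<open>\<alpha> < 1\<close> and positive cost no answer is acceptable. This supplies
  \<open>\<epsilon> \<le> 1\<close>, which the theorem does not assume.\<close>

lemma approximation_factor_ge_1:
  assumes "1 \<le> p" "2 \<le> n" "approximates_medoid_cost p n (2 * n) \<alpha> A"
  shows "1 \<le> \<alpha>"
proof (rule ccontr)
  assume "\<not> 1 \<le> \<alpha>"
  let ?x = "index_stream n 1 {} 0"
  let ?cost = "medoid_cost p (2 * n) (set ?x)"
  have "0 < ?cost"
    using medoid_cost_index_nonmember_ge[OF assms(1), of 1 n 0 "{}"] assms(2) by simp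
  then have "\<not> (?cost \<le> y \<and> y \<le> \<alpha> * ?cost)" for y
    using \<open>\<not> 1 \<le> \<alpha>\<close> mult_strict_right_mono[of \<alpha> 1 ?cost] by linarith
  then have "{r \<in> space coin_tape. ?cost \<le> final_answer A r ?x \<and> final_answer A r ?x \<le> \<alpha> * ?cost} = {}"
    by blast
  moreover have "9/10 \<le> \<P>(r in coin_tape. ?cost \<le> final_answer A r ?x \<and> final_answer A r ?x \<le> \<alpha> * ?cost)"
    using assms index_stream_permutation[of 1 n 0 "{}"] by (auto simp: approximates_medoid_cost_def)
  ultimately show False
    by (simp only: measure_empty)
qed

theorem theoremB3:
  fixes p :: real
  assumes "1 \<le> p"
  shows "\<exists>c>0. \<exists>N::nat. \<forall>n\<ge>N. \<forall>\<epsilon>::real. \<epsilon> \<ge> 10 / real n \<longrightarrow>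
           (\<forall>(A :: (nat \<Rightarrow> real) streaming_algorithm) (s :: nat).
              measurable_algorithm A \<longrightarrow>
              approximates_medoid_cost p n (2 * n) (2 - \<epsilon>) A \<longrightarrow>
              space_at_most n (2 * n) A s \<longrightarrow>
              real s \<ge> c * \<epsilon> * real n)"
proof (intro exI[of _ "1/20"] exI[of _ 2] conjI allI impI)
  fix n :: nat and \<epsilon> :: real and A :: "(nat \<Rightarrow> real) streaming_algorithm" and s :: nat
  assume n: "2 \<le> n" and \<epsilon>: "10 / real n \<le> \<epsilon>"
    and approx: "approximates_medoid_cost p n (2 * n) (2 - \<epsilon>) A"
    and space: "space_at_most n (2 * n) A s"
  have \<epsilon>1: "\<epsilon> \<le> 1"
    using approximation_factor_ge_1[OF assms n approx] by simp
  have \<epsilon>n: "10 \<le> \<epsilon> * n" "\<epsilon> * n \<le> n"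
    using \<epsilon> \<epsilon>1 n by (simp_all add: field_simps mult_left_le)
  \<comment> \<open>The largest \<open>m\<close> with \<open>2 * m \<le> \<epsilon> * n\<close>;
    then also \<open>2 * m \<le> n\<close> because \<open>\<epsilon> \<le> 1\<close>.\<close>
  define m where "m = nat \<lfloor>\<epsilon> * n / 2\<rfloor>"
  have m: "real m \<le> \<epsilon> * n / 2" "\<epsilon> * n / 2 < real m + 1" "5 \<le> m"
    using \<epsilon>n unfolding m_def by linarith+
  have "2 * m < 5 * (s + 1)"
    by (rule index_lower_bound[OF assms _ _ \<epsilon>1 _ approx space]) (use m \<epsilon>n in linarith)+
  then have "real (2 * m) < real (5 * (s + 1))" by (simp only: of_nat_less_iff)
  \<comment> \<open>With m \<ge> 5, \<epsilon> n < 2m + 2 \<le> 4m \<le> 4(2m - 5) < 20s, which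
    gives the constant 1/20.\<close>
  moreover have "5 \<le> real m" using m by simp
  ultimately show "1 / 20 * \<epsilon> * n \<le> s"
    using m(2) by (simp add: field_simps)
qed simp

end
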